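(* Let $T>0$ and let $\nu\in L^1(0,T)$ with $\nu>0$. Then $$\|J_\nu g\|_{W^{1,1}(0,T)}\le N(T)\left(|g(0)|+\|g\|_{W^{1,1}(0,T)}\right)\qquad\forall g\in W^{1,1}(0,T),$$ where $(J_\nu g)(x)=\int_0^x\nu(x-s)g(s)\,ds$ and $N(x)=\int_0^x\nu(s)\,ds$.
   Context: $W^{1,1}(0,T)$ is the usual Sobolev space with norm $\|g\|_{W^{1,1}(0,T)}=\|g\|_{L^1(0,T)}+\|g'\|_{L^1(0,T)}$; its elements are identified with their continuous representatives on $[0,T]$, so $g(0)$ is meaningful. Functions are real-valued. *)

theory Defs
  imports "HOL-Analysis.Analysis"
begin

text \<open>Functions on an interval are total functions on the reals; only their values on that
  interval matter.\<close>

definition L1_norm :: "real \<Rightarrow> (real \<Rightarrow> real) \<Rightarrow> real" where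
  "L1_norm T f = (LINT x:{0<..<T}|lebesgue. \<bar>f x\<bar>)"

text \<open>\<open>C\<^sub>c\<^sup>\<infinity>(0,T)\<close>, with test functions extended by zero to the whole line. The closed
  support is contained in \<open>(0,T)\<close>, hence bounded, hence compact.\<close>

definition test_functions :: "real \<Rightarrow> (real \<Rightarrow> real) set" where
  "test_functions T =
     {\<phi>. (\<forall>n x. (deriv ^^ n) \<phi> field_differentiable at x) \<and> closure {x. \<phi> x \<noteq> 0} \<subseteq> {0<..<T}}"

definition is_weak_deriv :: "real \<Rightarrow> (real \<Rightarrow> real) \<Rightarrow> (real \<Rightarrow> real) \<Rightarrow> bool" where
  "is_weak_deriv T g h \<longleftrightarrow>
     set_integrable lebesgue {0<..<T} h \<and>
     (\<forall>\<phi>\<in>test_functions T.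
        (LINT x:{0<..<T}|lebesgue. g x * deriv \<phi> x) = - (LINT x:{0<..<T}|lebesgue. h x * \<phi> x))"

text \<open>Elements of \<open>W\<^sup>1\<^sup>,\<^sup>1(0,T)\<close> are given by their continuous representatives on \<open>[0,T]\<close>, so
  that the value at \<open>0\<close> is meaningful.\<close>

definition W11 :: "real \<Rightarrow> (real \<Rightarrow> real) set" where
  "W11 T = {g. continuous_on {0..T} g \<and> set_integrable lebesgue {0<..<T} g \<and>
               (\<exists>h. is_weak_deriv T g h)}"

text \<open>The weak derivative is unique only up to null sets; the norm below does not depend on
  which version is chosen.\<close>

definition weak_deriv :: "real \<Rightarrow> (real \<Rightarrow> real) \<Rightarrow> real \<Rightarrow> real" where
  "weak_deriv T g = (SOME h. is_weak_deriv T g h)"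

definition W11_norm :: "real \<Rightarrow> (real \<Rightarrow> real) \<Rightarrow> real" where
  "W11_norm T g = L1_norm T g + L1_norm T (weak_deriv T g)"

definition conv_op :: "(real \<Rightarrow> real) \<Rightarrow> (real \<Rightarrow> real) \<Rightarrow> real \<Rightarrow> real" where
  "conv_op \<nu> g x = (LINT s:{0<..<x}|lebesgue. \<nu> (x - s) * g s)"

definition kernel_integral :: "(real \<Rightarrow> real) \<Rightarrow> real \<Rightarrow> real" where
  "kernel_integral \<nu> x = (LINT s:{0<..<x}|lebesgue. \<nu> s)"

end

theory Submission
  imports Defs "HOL-Real_Asymp.Real_Asymp"
begin

text \<open>If \<open>g\<close> has weak derivative \<open>h\<close>, then \<open>g x = g 0 + H x\<close> with \<open>H x\<close> the integral of \<open>h\<close>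
  over \<open>(0,x)\<close>. Convolution with \<open>\<nu>\<close> commutes with taking primitives, so
  \<open>J\<^sub>\<nu> g = g 0 \<cdot> N + \<nu> * H\<close> is the primitive of \<open>k = g 0 \<cdot> \<nu> + \<nu> * h\<close>. A primitive is
  continuous, and its integrand is its weak derivative; hence \<open>J\<^sub>\<nu> g\<close> belongs to
  \<open>W\<^sup>1\<^sup>,\<^sup>1\<close> with \<open>(J\<^sub>\<nu> g)' = k\<close>. Positivity of the kernel makes \<open>N T\<close> the \<open>L\<^sup>1\<close>
  norm of \<open>\<nu>\<close>, so Young's inequality gives \<open>\<parallel>J\<^sub>\<nu> g\<parallel> \<le> N T \<cdot> \<parallel>g\<parallel>\<close> and
  \<open>\<parallel>k\<parallel> \<le> N T \<cdot> (\<bar>g 0\<bar> + \<parallel>h\<parallel>)\<close> in \<open>L\<^sup>1\<close>, and the two bounds add up to the claim. The value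
  \<open>g 0\<close> appears because the extension of \<open>g\<close> by zero jumps at the origin.

  Two facts about weak derivatives support this. By \<open>weak_deriv_unique_AE\<close> the norm may be computed
  from \<open>k\<close>, whichever weak derivative is selected; by \<open>W11_eq_primitive\<close> an element of
  \<open>W\<^sup>1\<^sup>,\<^sup>1\<close> is its value at \<open>0\<close> plus the primitive of its weak derivative. Both rest on the fundamental lemma of the
  calculus of variations, \<open>AE_eq_0_if_orthogonal_to_test_functions\<close>. There the test functions
  \<open>f (n (x - a)) f (n (b - x))\<close> built from the flat function \<open>f x = exp (- 1 / x)\<close> for
  \<open>x > 0\<close> converge boundedly to the indicator of \<open>(a,b)\<close>.

  Convolutions are taken over Borel representatives extended by zero to the whole line, because
  \<open>(s, x) \<mapsto> \<nu> (x - s)\<close> is then measurable for the product of two copies of \<open>lborel\<close>, and Fubini's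
  theorem applies.\<close>

section \<open>Smooth functions of one real variable\<close>

definition smooth :: "(real \<Rightarrow> real) \<Rightarrow> bool" where
  "smooth f \<longleftrightarrow> (\<forall>n x. (deriv ^^ n) f field_differentiable at x)"

lemma smooth_DERIV:
  assumes "smooth f" shows "(f has_real_derivative deriv f x) (at x)"
  using assms unfolding smooth_def
  by (metis DERIV_deriv_iff_field_differentiable funpow_0)

lemma smooth_deriv: assumes "smooth f" shows "smooth (deriv f)"
  using assms unfolding smooth_def by (metis funpow_simps_right(2) o_apply)

text \<open>Smoothness is the largest family of functions that is closed under differentiation. This principle
replaces explicit formulas for the iterated derivatives of products and compositions.\<close>

lemma smooth_coinduct:
  assumes "f \<in> S"
    and step: "\<And>f. f \<in> S \<Longrightarrow> \<exists>f'\<in>S. \<forall>x. (f has_real_derivative f' x) (at x)"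
  shows "smooth f"
proof -
  have "(deriv ^^ n) f \<in> S" for n
  proof (induction n)
    case (Suc n)
    then obtain f' where f': "f' \<in> S" "\<And>x. ((deriv ^^ n) f has_real_derivative f' x) (at x)"
      using step by blast
    then have "(deriv ^^ Suc n) f = f'" by (auto intro!: ext DERIV_imp_deriv)
    with f' show ?case by simp
  qed (use assms in simp)
  then show ?thesis
    using step unfolding smooth_def field_differentiable_def by blast
qed

lemma smoothI:
  assumes "\<And>x. (f has_real_derivative f' x) (at x)" and "smooth f'"
  shows "smooth f"
proof (rule smooth_coinduct)
  show "f \<in> insert f {g. smooth g}" by simp
  show "\<exists>h'\<in>insert f {g. smooth g}. \<forall>x. (h has_real_derivative h' x) (at x)"
    if "h \<in> insert f {g. smooth g}" for h
    using that assms smooth_DERIV smooth_deriv by blast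
qed

lemma smooth_const: "smooth (\<lambda>x. c)"
  by (rule smooth_coinduct[where S="range (\<lambda>c x. c)"]) (auto intro!: exI[of _ 0])

text \<open>An auxiliary family that is closed under differentiation by the rules of calculus, so that
\<open>smooth_coinduct\<close> applies to it; it shows that sums, products and affine substitutions preserve
smoothness.\<close>

inductive_set smooth_algebra :: "(real \<Rightarrow> real) set" where
  base: "smooth f \<Longrightarrow> f \<in> smooth_algebra"
| add: "f \<in> smooth_algebra \<Longrightarrow> g \<in> smooth_algebra \<Longrightarrow> (\<lambda>x. f x + g x) \<in> smooth_algebra"
| mult: "f \<in> smooth_algebra \<Longrightarrow> g \<in> smooth_algebra \<Longrightarrow> (\<lambda>x. f x * g x) \<in> smooth_algebra"
| affine: "f \<in> smooth_algebra \<Longrightarrow> (\<lambda>x. f (c * x + d)) \<in> smooth_algebra"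

lemma smooth_algebra_imp_smooth: assumes "f \<in> smooth_algebra" shows "smooth f"
proof (rule smooth_coinduct[OF assms])
  fix f assume "f \<in> smooth_algebra"
  then show "\<exists>f'\<in>smooth_algebra. \<forall>x. (f has_real_derivative f' x) (at x)"
  proof induction
    case (base f)
    then show ?case using smooth_DERIV smooth_deriv smooth_algebra.base by blast
  next
    case (add f g)
    then obtain f' g' where "f' \<in> smooth_algebra" "g' \<in> smooth_algebra"
      and "\<And>x. (f has_real_derivative f' x) (at x)" "\<And>x. (g has_real_derivative g' x) (at x)"
      by blast
    then show ?case
      by (intro bexI[of _ "\<lambda>x. f' x + g' x"])
        (auto intro!: derivative_eq_intros smooth_algebra.add)
  next
    case (mult f g)
    then obtain f' g' where "f' \<in> smooth_algebra" "g' \<in> smooth_algebra"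
      and "\<And>x. (f has_real_derivative f' x) (at x)" "\<And>x. (g has_real_derivative g' x) (at x)"
      by blast
    with mult show ?case
      by (intro bexI[of _ "\<lambda>x. f' x * g x + f x * g' x"])
        (auto intro!: derivative_eq_intros smooth_algebra.add smooth_algebra.mult)
  next
    case (affine f c d)
    then obtain f' where f': "f' \<in> smooth_algebra" "\<And>x. (f has_real_derivative f' x) (at x)"
      by blast
    have "(\<lambda>x. c * f' (c * x + d)) \<in> smooth_algebra"
      using f' smooth_algebra.base[OF smooth_const]
      by (intro smooth_algebra.mult[of "\<lambda>x. c"] smooth_algebra.affine[of f']) auto
    moreover have "((\<lambda>x. f (c * x + d)) has_real_derivative c * f' (c * x + d)) (at x)" for x
    proof -
      have "((\<lambda>x. c * x + d) has_real_derivative c) (at x)"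
        by (auto intro!: derivative_eq_intros)
      from DERIV_chain2[OF f'(2) this] show ?thesis by (simp add: mult.commute)
    qed
    ultimately show ?case by (intro bexI[of _ "\<lambda>x. c * f' (c * x + d)"]) auto
  qed
qed

lemma smooth_mult: "smooth f \<Longrightarrow> smooth g \<Longrightarrow> smooth (\<lambda>x. f x * g x)"
  by (rule smooth_algebra_imp_smooth[OF smooth_algebra.mult[OF smooth_algebra.base smooth_algebra.base]])

lemma smooth_affine: "smooth f \<Longrightarrow> smooth (\<lambda>x. f (c * x + d))"
  by (rule smooth_algebra_imp_smooth[OF smooth_algebra.affine[OF smooth_algebra.base]])

lemma smooth_diff: "smooth f \<Longrightarrow> smooth g \<Longrightarrow> smooth (\<lambda>x. f x - g x)"
proof -
  assume "smooth f" "smooth g"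
  then have "smooth (\<lambda>x. f x + (-1) * g x)"
    by (rule smooth_algebra_imp_smooth[OF smooth_algebra.add[OF smooth_algebra.base
            smooth_algebra.mult[OF smooth_algebra.base[OF smooth_const] smooth_algebra.base]]])
  then show ?thesis by simp
qed

section \<open>Flat functions and test functions\<close>

text \<open>The polynomial factor keeps the family closed under differentiation; the classical flat function is
\<open>flat 1\<close>.\<close>

definition flat :: "real poly \<Rightarrow> real \<Rightarrow> real" where
  "flat p x = (if x \<le> 0 then 0 else poly p (1 / x) * exp (- (1 / x)))"

lemma poly_times_exp_tendsto_0:
  fixes p :: "real poly"
  shows "((\<lambda>y. poly p y * exp (- y)) \<longlongrightarrow> 0) at_top"
proof -
  have "((\<lambda>y. \<Sum>i\<le>degree p. coeff p i * (y ^ i / exp y)) \<longlongrightarrow>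
      (\<Sum>i\<le>degree p. coeff p i * 0)) at_top"
    by (intro tendsto_intros tendsto_power_div_exp_0)
  then show ?thesis
    by (simp add: poly_altdef sum_divide_distrib sum_distrib_right exp_minus divide_inverse mult.assoc)
qed

text \<open>To the right of \<open>0\<close> this is the product rule in the variable \<open>y = 1 / x\<close>, where \<open>d/dx = - y\<^sup>2 d/dy\<close>.
At \<open>0\<close> the difference quotient from the right is a polynomial in \<open>y\<close> times \<open>exp (- y)\<close>, which
tends to \<open>0\<close> as \<open>y \<longlongrightarrow> \<infinity>\<close>.\<close>

lemma flat_has_derivative:
  "(flat p has_real_derivative flat (monom 1 2 * (p - pderiv p)) x) (at x)"
proof (cases x "0 :: real" rule: linorder_cases)
  case less
  have "((\<lambda>x. 0) has_real_derivative 0) (at x)" by simp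
  then have "(flat p has_real_derivative 0) (at x)"
    by (rule DERIV_cong_ev[THEN iffD1, rotated -1])
       (use less in \<open>auto simp: flat_def intro!: eventually_mono[OF eventually_nhds_in_open[of "{..<0}"]]\<close>)
  then show ?thesis using less by (simp add: flat_def)
next
  case greater
  have "((\<lambda>x. poly p (1 / x) * exp (- (1 / x))) has_real_derivative
      flat (monom 1 2 * (p - pderiv p)) x) (at x)"
    using greater
    by (auto intro!: derivative_eq_intros simp: flat_def poly_monom field_simps power2_eq_square)
  then show ?thesis
    by (rule DERIV_cong_ev[THEN iffD1, rotated -1])
       (use greater in \<open>auto simp: flat_def intro!: eventually_mono[OF eventually_nhds_in_open[of "{0<..}"]]\<close>)
next
  case equal
  have "((\<lambda>h. flat p h / h) \<longlongrightarrow> 0) (at 0)"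
  proof (rule filterlim_split_at)
    show "((\<lambda>h. flat p h / h) \<longlongrightarrow> 0) (at_left 0)"
      by (rule tendsto_eventually) (auto simp: flat_def eventually_at_filter)
    have "((\<lambda>h. poly (pCons 0 p) (inverse h) * exp (- inverse h)) \<longlongrightarrow> 0) (at_right (0::real))"
      using poly_times_exp_tendsto_0[of "pCons 0 p"] filterlim_inverse_at_top_right
      by (rule filterlim_compose)
    then show "((\<lambda>h. flat p h / h) \<longlongrightarrow> 0) (at_right 0)"
      by (rule Lim_transform_eventually)
         (auto simp: flat_def eventually_at_filter divide_inverse)
  qed
  then show ?thesis using equal
    by (simp add: has_field_derivative_iff flat_def[of p 0] flat_def[of _ 0])
qed

lemma smooth_flat: "smooth (flat p)"
  by (rule smooth_coinduct[where S="range flat"]) (auto intro: flat_has_derivative)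

lemma test_functionsI:
  assumes "smooth \<phi>" "\<And>x. x \<notin> {a..b} \<Longrightarrow> \<phi> x = 0" "0 < a" "b < T"
  shows "\<phi> \<in> test_functions T"
proof -
  have "closure {x. \<phi> x \<noteq> 0} \<subseteq> {a..b}"
    using assms(2) by (intro closure_minimal) (blast, simp)
  then show ?thesis using assms unfolding test_functions_def smooth_def by force
qed

text \<open>The support of a nonzero test function is compact, so it has a least and a greatest element, both
inside the open interval. The zero function is a separate case because its support is empty.\<close>

lemma test_functionsE:
  assumes "\<phi> \<in> test_functions T"
  obtains a b where "smooth \<phi>" "\<And>x. x \<notin> {a..b} \<Longrightarrow> \<phi> x = 0" "0 < a" "a \<le> b" "b < T"
    | "\<phi> = (\<lambda>x. 0)"
proof -
  define K where "K = closure {x. \<phi> x \<noteq> 0}"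
  have K: "K \<subseteq> {0<..<T}" and sm: "smooth \<phi>"
    using assms by (auto simp: test_functions_def smooth_def K_def)
  have \<phi>K: "x \<in> K" if "\<phi> x \<noteq> 0" for x using that closure_subset by (force simp: K_def)
  have "compact K"
    unfolding compact_eq_bounded_closed using bounded_subset[OF bounded_Ioo K] by (simp add: K_def)
  show thesis
  proof (cases "K = {}")
    case True
    then show thesis using \<phi>K that(2) by blast
  next
    case False
    obtain a where a: "a \<in> K" "\<And>x. x \<in> K \<Longrightarrow> a \<le> x"
      using compact_attains_inf[OF \<open>compact K\<close> False] by blast
    obtain b where b: "b \<in> K" "\<And>x. x \<in> K \<Longrightarrow> x \<le> b"
      using compact_attains_sup[OF \<open>compact K\<close> False] by blast
    have "0 < a" "b < T" using a b K by auto
    moreover have "\<phi> x = 0" if "x \<notin> {a..b}" for x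
      using \<phi>K[of x] a(2)[of x] b(2)[of x] that by auto
    ultimately show thesis using that(1)[of a b] sm a(1) b(2) by blast
  qed
qed

text \<open>A smooth function, zero outside \<open>(a,b)\<close>, that approaches the indicator of \<open>(a,b)\<close> as \<open>n\<close> grows.\<close>

definition bump :: "real \<Rightarrow> real \<Rightarrow> nat \<Rightarrow> real \<Rightarrow> real" where
  "bump a b n x = flat 1 (real n * (x - a)) * flat 1 (real n * (b - x))"

lemma smooth_bump: "smooth (bump a b n)"
proof -
  have "smooth (\<lambda>x. flat 1 (real n * x + - real n * a) * flat 1 (- real n * x + real n * b))"
    by (rule smooth_mult[OF smooth_affine[OF smooth_flat] smooth_affine[OF smooth_flat]])
  moreover have "bump a b n = (\<lambda>x. flat 1 (real n * x + - real n * a) * flat 1 (- real n * x + real n * b))"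
    by (auto simp: bump_def algebra_simps)
  ultimately show ?thesis by simp
qed

lemma flat_1_bounds: "0 \<le> flat 1 x" "flat 1 x \<le> 1"
  by (auto simp: flat_def)

lemma bump_bound: "\<bar>bump a b n x\<bar> \<le> 1"
  using flat_1_bounds by (auto simp: bump_def abs_mult intro!: mult_le_one)

lemma bump_eq_0: "x \<notin> {a<..<b} \<Longrightarrow> bump a b n x = 0"
  by (auto simp: bump_def flat_def mult_le_0_iff not_less)

text \<open>For fixed \<open>y > 0\<close> the argument \<open>n y\<close> tends to infinity, where \<open>flat 1\<close> tends to \<open>1\<close>; outside
\<open>(a,b)\<close> one of the factors is exactly \<open>0\<close> for every \<open>n\<close>.\<close>

lemma bump_tendsto: "(\<lambda>n. bump a b n x) \<longlonglongrightarrow> indicator {a<..<b} x"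
proof (cases "x \<in> {a<..<b}")
  case True
  have *: "(\<lambda>n. flat 1 (real n * y)) \<longlonglongrightarrow> 1" if "y > 0" for y
  proof -
    have "(\<lambda>n. exp (- (1 / (real n * y)))) \<longlonglongrightarrow> 1" using that by real_asymp
    moreover have "\<forall>\<^sub>F n in sequentially. exp (- (1 / (real n * y))) = flat 1 (real n * y)"
      using eventually_gt_at_top[of 0] by eventually_elim (use that in \<open>auto simp: flat_def mult_le_0_iff\<close>)
    ultimately show ?thesis by (rule Lim_transform_eventually)
  qed
  have "(\<lambda>n. bump a b n x) \<longlonglongrightarrow> 1 * 1"
    unfolding bump_def by (intro tendsto_mult *) (use True in auto)
  then show ?thesis using True by simp
qed (simp add: bump_eq_0)

section \<open>Primitives of integrable functions\<close>

lemma integrable_lborel_mult_bounded: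
  fixes f g :: "real \<Rightarrow> real"
  assumes "integrable lborel f" "g \<in> borel_measurable borel" "\<And>x. \<bar>g x\<bar> \<le> C"
  shows "integrable lborel (\<lambda>x. f x * g x)"
proof (rule Bochner_Integration.integrable_bound)
  show "integrable lborel (\<lambda>x. C * f x)" using assms by simp
  show "AE x in lborel. norm (f x * g x) \<le> norm (C * f x)"
    using assms(3) by (intro AE_I2) (simp add: abs_mult mult.commute[of C] mult_left_mono order_trans[OF _ abs_ge_self])
qed (use assms in measurable)

definition primitive :: "(real \<Rightarrow> real) \<Rightarrow> real \<Rightarrow> real" where
  "primitive f x = (LINT y|lborel. f y * indicator {..x} y)"

lemma integrable_lborel_indicator:
  fixes f :: "real \<Rightarrow> real"
  shows "integrable lborel f \<Longrightarrow> A \<in> sets borel \<Longrightarrow> integrable lborel (\<lambda>x. f x * indicator A x)"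
  by (rule integrable_real_mult_indicator) auto

lemma primitive_diff:
  assumes "integrable lborel f" "a \<le> b"
  shows "primitive f b - primitive f a = (LINT y|lborel. f y * indicator {a..b} y)"
proof -
  have "primitive f b - primitive f a =
      (LINT y|lborel. f y * indicator {..b} y - f y * indicator {..a} y)"
    unfolding primitive_def using assms
    by (intro Bochner_Integration.integral_diff[symmetric] integrable_lborel_indicator) auto
  also have "\<dots> = (LINT y|lborel. f y * indicator {a..b} y)"
  proof (rule integral_cong_AE)
    show "AE y in lborel. f y * indicator {..b} y - f y * indicator {..a} y = f y * indicator {a..b} y"
      using AE_lborel_singleton[of a]
      by eventually_elim (use assms(2) in \<open>auto simp: indicator_def\<close>)
  qed (use assms(1) in auto)
  finally show ?thesis .
qed

text \<open>Dominated convergence: as the endpoint varies the integrands converge at every point other than the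
limiting endpoint, and they are bounded by \<open>\<bar>f\<bar>\<close>.\<close>

lemma continuous_primitive:
  assumes [measurable]: "integrable lborel f"
  shows "continuous_on UNIV (primitive f)"
proof -
  have "isCont (primitive f) x" for x
  proof (rule continuous_at_sequentiallyI)
    fix u :: "nat \<Rightarrow> real" assume u: "u \<longlonglongrightarrow> x"
    show "(\<lambda>n. primitive f (u n)) \<longlonglongrightarrow> primitive f x"
      unfolding primitive_def
    proof (rule integral_dominated_convergence[where w="\<lambda>y. \<bar>f y\<bar>"])
      show "AE y in lborel. (\<lambda>n. f y * indicator {..u n} y) \<longlonglongrightarrow> f y * indicator {..x} y"
        using AE_lborel_singleton[of x]
      proof eventually_elim
        fix y assume "y \<noteq> x"
        have "\<forall>\<^sub>F n in sequentially. f y * indicator {..x} y = f y * indicator {..u n} y"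
        proof (cases "y < x")
          case True
          from order_tendstoD(1)[OF u True] show ?thesis
            by eventually_elim (use True in \<open>auto simp: indicator_def\<close>)
        next
          case False
          with \<open>y \<noteq> x\<close> have "x < y" by simp
          from order_tendstoD(2)[OF u this] show ?thesis
            by eventually_elim (use \<open>x < y\<close> in \<open>auto simp: indicator_def\<close>)
        qed
        then show "(\<lambda>n. f y * indicator {..u n} y) \<longlonglongrightarrow> f y * indicator {..x} y"
          by (rule Lim_transform_eventually[OF tendsto_const])
      qed
    qed (use assms in \<open>auto simp: indicator_def\<close>)
  qed
  then show ?thesis by (simp add: continuous_at_imp_continuous_on)
qed

text \<open>The Borel sets over which \<open>f\<close> integrates to \<open>0\<close> contain the compact intervals and are closed under
complements and disjoint countable unions; by Dynkin's theorem they are all the Borel sets.\<close>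

lemma integral_intervals_eq_0_imp_AE_eq_0:
  fixes f :: "real \<Rightarrow> real"
  assumes f: "integrable lborel f"
    and int: "\<And>a b. a \<le> b \<Longrightarrow> (LINT x|lborel. f x * indicator {a..b} x) = 0"
    and total: "(LINT x|lborel. f x) = 0"
  shows "AE x in lborel. f x = 0"
proof (rule sigma_finite_measure.density_zero[OF sigma_finite_lborel f])
  fix A :: "real set" assume "A \<in> sets lborel"
  then have "A \<in> sets borel" by simp
  then show "set_lebesgue_integral lborel A f = 0"
  proof (induction rule: borel_set_induct)
    case (compl A)
    have "set_lebesgue_integral lborel (- A) f =
        (LINT x|lborel. f x - indicator A x *\<^sub>R f x)"
      unfolding set_lebesgue_integral_def
      by (rule Bochner_Integration.integral_cong) (auto split: split_indicator)
    also have "\<dots> = (LINT x|lborel. f x) - set_lebesgue_integral lborel A f"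
      unfolding set_lebesgue_integral_def
      by (intro Bochner_Integration.integral_diff f integrable_mult_indicator) (use compl in simp)
    finally show ?case using total compl by simp
  next
    case (union F)
    have "set_lebesgue_integral lborel (\<Union>i. F i) f = (\<Sum>i. set_lebesgue_integral lborel (F i) f)"
      by (rule lebesgue_integral_countable_add)
        (use f union in \<open>auto simp: set_integrable_def disjoint_family_on_def
           simp del: real_scaleR_def intro!: integrable_mult_indicator sets.countable_UN\<close>)
    then show ?case using union by simp
  qed (use int in \<open>simp_all add: set_lebesgue_integral_def mult.commute\<close>)
qed

lemma continuous_compact_support_integrable:
  fixes f :: "real \<Rightarrow> real"
  assumes "continuous_on UNIV f" "\<And>x. x \<notin> {a..b} \<Longrightarrow> f x = 0"
  shows "integrable lborel f"
proof -
  have "integrable lborel (\<lambda>x. indicator {a..b} x *\<^sub>R f x)"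
    using borel_integrable_atLeastAtMost'[OF continuous_on_subset[OF assms(1), of "{a..b}"]]
    by (simp add: set_integrable_def)
  moreover have "(\<lambda>x. indicator {a..b} x *\<^sub>R f x) = f"
    using assms(2) by (auto split: split_indicator)
  ultimately show ?thesis by simp
qed

lemma smooth_continuous: "smooth f \<Longrightarrow> continuous_on UNIV f"
  by (meson DERIV_isCont continuous_at_imp_continuous_on smooth_DERIV)

lemma deriv_eq_0_outside:
  fixes \<phi> :: "real \<Rightarrow> real"
  assumes "\<And>x. x \<notin> {a..b} \<Longrightarrow> \<phi> x = 0" "x \<notin> {a..b}"
  shows "deriv \<phi> x = 0"
proof (rule DERIV_imp_deriv)
  have "((\<lambda>x. 0) has_real_derivative 0) (at x)" by simp
  moreover have "\<forall>\<^sub>F y in nhds x. \<phi> y = 0"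
    using eventually_nhds_in_open[of "- {a..b}" x] assms
    by (auto elim!: eventually_mono simp: open_Compl)
  ultimately show "(\<phi> has_real_derivative 0) (at x)"
    by (subst DERIV_cong_ev[OF refl _ refl])
qed

text \<open>The fundamental theorem of calculus up to a point to the right of the support, where \<open>\<phi>\<close>
vanishes.\<close>

lemma integral_deriv_Ici:
  assumes "smooth \<phi>" "\<And>x. x \<notin> {a..b} \<Longrightarrow> \<phi> x = 0"
  shows "(LINT x|lborel. deriv \<phi> x * indicator {s..} x) = - \<phi> s"
proof -
  \<comment> \<open>Any point that is at least \<open>s\<close> and strictly to the right of the support.\<close>
  define c where "c = max s (b + 1)"
  have "(LINT x|lborel. deriv \<phi> x * indicator {s..} x) = (LINT x|lborel. deriv \<phi> x * indicator {s..c} x)"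
  proof (intro Bochner_Integration.integral_cong refl)
    show "deriv \<phi> x * indicator {s..} x = deriv \<phi> x * indicator {s..c} x" for x
      using deriv_eq_0_outside[of a b \<phi> x, OF assms(2)]
      by (cases "x \<le> b") (auto simp: c_def indicator_def)
  qed
  also have "\<dots> = \<phi> c - \<phi> s"
    by (rule integral_FTC_Icc_real)
      (use smooth_DERIV[OF assms(1)] DERIV_isCont[OF smooth_DERIV[OF smooth_deriv[OF assms(1)]]]
        in \<open>auto simp: c_def\<close>)
  also have "\<phi> c = 0" by (rule assms(2)) (auto simp: c_def)
  finally show ?thesis by simp
qed

lemma integral_deriv_eq_0:
  assumes "smooth \<phi>" "\<And>x. x \<notin> {a..b} \<Longrightarrow> \<phi> x = 0"
  shows "(LINT x|lborel. deriv \<phi> x) = 0"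
proof -
  have "(LINT x|lborel. deriv \<phi> x) = (LINT x|lborel. deriv \<phi> x * indicator {a - 1..} x)"
    using deriv_eq_0_outside[of a b \<phi>] assms(2)
    by (intro Bochner_Integration.integral_cong) (auto split: split_indicator)
  also have "\<dots> = - \<phi> (a - 1)" using assms by (rule integral_deriv_Ici)
  finally show ?thesis using assms(2)[of "a - 1"] by simp
qed

lemma integrable_pair_mult:
  fixes f g :: "real \<Rightarrow> real"
  assumes "integrable lborel f" "integrable lborel g"
  shows "integrable (lborel \<Otimes>\<^sub>M lborel) (\<lambda>(x, y). f x * g y)"
  by (rule lborel_pair.Fubini_integrable) (use assms in \<open>auto simp: abs_mult\<close>)

text \<open>Integration by parts for a primitive that is differentiable only almost everywhere. Exchanging the
order of integration moves the inner integral onto \<open>\<phi>'\<close>, and the integral of \<open>\<phi>'\<close> over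
\<open>[y,\<infinity>)\<close> is \<open>- \<phi> y\<close>.\<close>

lemma integral_primitive_mult_deriv:
  assumes f: "integrable lborel f" and \<phi>: "smooth \<phi>" "\<And>x. x \<notin> {a..b} \<Longrightarrow> \<phi> x = 0"
  shows "(LINT x|lborel. primitive f x * deriv \<phi> x) = - (LINT x|lborel. f x * \<phi> x)"
proof -
  have d: "integrable lborel (deriv \<phi>)"
    by (rule continuous_compact_support_integrable[of _ a b])
      (use \<phi> in \<open>auto intro!: smooth_continuous smooth_deriv deriv_eq_0_outside[of a b]\<close>)
  have [measurable]: "f \<in> borel_measurable borel" "deriv \<phi> \<in> borel_measurable borel"
    using f d by auto
  have "integrable (lborel \<Otimes>\<^sub>M lborel) (\<lambda>(x, y). deriv \<phi> x * f y * indicator {..x} y)"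
    by (rule Bochner_Integration.integrable_bound[OF integrable_pair_mult[OF d f]])
       (auto simp: indicator_def split_beta' intro!: AE_I2)
  from lborel_pair.Fubini_integral[OF this]
  have "(LINT x|lborel. LINT y|lborel. deriv \<phi> x * f y * indicator {..x} y) =
      (LINT y|lborel. LINT x|lborel. deriv \<phi> x * f y * indicator {..x} y)" by simp
  also have "\<dots> = (LINT y|lborel. f y * (LINT x|lborel. deriv \<phi> x * indicator {y..} x))"
    by (auto simp: indicator_def mult_ac intro!: Bochner_Integration.integral_cong simp flip: integral_mult_right_zero)
  also have "\<dots> = - (LINT x|lborel. f x * \<phi> x)"
    using integral_deriv_Ici[of \<phi> a b] \<phi> by simp
  also have "(LINT x|lborel. LINT y|lborel. deriv \<phi> x * f y * indicator {..x} y) = (LINT x|lborel. primitive f x * deriv \<phi> x)"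
    unfolding primitive_def by (auto simp: mult_ac simp flip: integral_mult_right_zero)
  finally show ?thesis .
qed

section \<open>Borel representatives\<close>

text \<open>Passage from Lebesgue integrals over a set to Borel integrals over the line. Measurability of \<open>F\<close> on
\<open>A\<close> is a consequence: Lebesgue measure is complete.\<close>

lemma set_lebesgue_integral_lborel:
  fixes F G :: "real \<Rightarrow> real"
  assumes "G \<in> borel_measurable borel" "AE x in lborel. indicator A x * F x = G x"
  shows "(LINT x:A|lebesgue. F x) = (LINT x|lborel. G x)"
    and "set_integrable lebesgue A F \<longleftrightarrow> integrable lborel G"
proof -
  have ae: "AE x in lebesgue. G x = indicator A x * F x"
    using assms(2) by (auto simp: AE_completion_iff elim!: eventually_mono)
  have G: "G \<in> borel_measurable lebesgue"
    using assms(1) by (simp add: measurable_completion)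
  have F: "(\<lambda>x. indicator A x * F x) \<in> borel_measurable lebesgue"
    by (rule borel_measurable_AE[OF G ae])
  have "(LINT x:A|lebesgue. F x) = (LINT x|lebesgue. G x)"
    unfolding set_lebesgue_integral_def real_scaleR_def
    by (rule integral_cong_AE[OF F G]) (use ae in \<open>auto elim!: eventually_mono\<close>)
  then show "(LINT x:A|lebesgue. F x) = (LINT x|lborel. G x)"
    using assms(1) by (simp add: integral_completion)
  have "set_integrable lebesgue A F \<longleftrightarrow> integrable lebesgue G"
    unfolding set_integrable_def real_scaleR_def
    by (rule integrable_cong_AE[OF F G]) (use ae in \<open>auto elim!: eventually_mono\<close>)
  then show "set_integrable lebesgue A F \<longleftrightarrow> integrable lborel G"
    using assms(1) by (simp add: integrable_completion)
qed

text \<open>A Borel function that represents the class of \<open>f\<close> in \<open>L\<^sup>1(0,T)\<close>, extended by zero so that integrals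
over the line and convolutions make sense.\<close>

definition L1_representative :: "real \<Rightarrow> (real \<Rightarrow> real) \<Rightarrow> (real \<Rightarrow> real) \<Rightarrow> bool" where
  "L1_representative T f f' \<longleftrightarrow> integrable lborel f' \<and> (\<forall>x. x \<notin> {0<..<T} \<longrightarrow> f' x = 0) \<and>
     (AE x in lborel. x \<in> {0<..<T} \<longrightarrow> f x = f' x)"

lemma L1_representative_exists:
  assumes "set_integrable lebesgue {0<..<T} f"
  obtains f' where "L1_representative T f f'"
proof -
  have "(\<lambda>x. indicator {0<..<T} x * f x) \<in> borel_measurable (completion lborel)"
    using assms by (auto simp: set_integrable_def)
  from completion_ex_borel_measurable_real[OF this]
  obtain g where g: "g \<in> borel_measurable borel" "AE x in lborel. indicator {0<..<T} x * f x = g x"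
    by auto
  define f' where "f' x = indicator {0<..<T} x * g x" for x
  have ae: "AE x in lborel. indicator {0<..<T} x * f x = f' x"
    using g(2) by eventually_elim (auto simp: f'_def split: split_indicator split_indicator_asm)
  have [measurable]: "f' \<in> borel_measurable borel" using g(1) by (simp add: f'_def[abs_def])
  have "integrable lborel f'"
    using set_lebesgue_integral_lborel(2)[OF _ ae] assms by simp
  moreover have "AE x in lborel. x \<in> {0<..<T} \<longrightarrow> f x = f' x"
    using ae by eventually_elim (auto split: split_indicator_asm)
  ultimately have "L1_representative T f f'"
    by (auto simp: L1_representative_def f'_def)
  then show thesis by (rule that)
qed

lemma L1_representative_AE:
  "L1_representative T f f' \<Longrightarrow> AE x in lborel. indicator {0<..<T} x * f x = f' x"
  unfolding L1_representative_def by (auto simp: indicator_def elim!: eventually_mono)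

lemma L1_representative_integral_mult:
  assumes "L1_representative T f f'" "\<phi> \<in> borel_measurable borel"
  shows "(LINT x:{0<..<T}|lebesgue. f x * \<phi> x) = (LINT x|lborel. f' x * \<phi> x)"
proof (rule set_lebesgue_integral_lborel(1))
  show "(\<lambda>x. f' x * \<phi> x) \<in> borel_measurable borel"
    using assms by (auto simp: L1_representative_def)
  show "AE x in lborel. indicator {0<..<T} x * (f x * \<phi> x) = f' x * \<phi> x"
    using L1_representative_AE[OF assms(1)] by eventually_elim (auto simp flip: mult.assoc)
qed

lemma L1_norm_representative:
  assumes "L1_representative T f f'"
  shows "L1_norm T f = (LINT x|lborel. \<bar>f' x\<bar>)"
  unfolding L1_norm_def
proof (rule set_lebesgue_integral_lborel(1))
  show "(\<lambda>x. \<bar>f' x\<bar>) \<in> borel_measurable borel"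
    using assms by (auto simp: L1_representative_def)
  show "AE x in lborel. indicator {0<..<T} x * \<bar>f x\<bar> = \<bar>f' x\<bar>"
    using L1_representative_AE[OF assms] by eventually_elim (auto split: split_indicator split_indicator_asm)
qed

section \<open>Uniqueness of weak derivatives\<close>

text \<open>The fundamental lemma of the calculus of variations. The bump functions show that \<open>f\<close> integrates to
\<open>0\<close> over \<open>(a,b)\<close> whenever \<open>0 < a \<le> b < T\<close>, so its primitive is constant on \<open>(0,T)\<close>. By
continuity the constant extends to \<open>[0,T]\<close>, and it is the value at \<open>0\<close>, which is \<open>0\<close>. Hence all
integrals of \<open>f\<close> over intervals vanish.\<close>

lemma AE_eq_0_if_orthogonal_to_test_functions:
  assumes f: "integrable lborel f" "\<And>x. x \<notin> {0<..<T} \<Longrightarrow> f x = 0" "T > 0"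
    and orth: "\<And>\<phi>. \<phi> \<in> test_functions T \<Longrightarrow> (LINT x|lborel. f x * \<phi> x) = 0"
  shows "AE x in lborel. f x = 0"
proof -
  have inner: "primitive f b - primitive f a = 0" if "0 < a" "a \<le> b" "b < T" for a b
  proof -
    have "(LINT x|lborel. f x * bump a b n x) = 0" for n
      by (rule orth[OF test_functionsI[OF smooth_bump, of a b]])
        (use that bump_eq_0 in auto)
    moreover have "(\<lambda>n. LINT x|lborel. f x * bump a b n x) \<longlonglongrightarrow> (LINT x|lborel. f x * indicator {a<..<b} x)"
    proof (rule integral_dominated_convergence[where w="\<lambda>x. \<bar>f x\<bar>"])
      show "(\<lambda>x. f x * bump a b n x) \<in> borel_measurable lborel" for n
        using f(1) borel_measurable_continuous_onI[OF smooth_continuous[OF smooth_bump]] by simp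
      show "AE x in lborel. norm (f x * bump a b n x) \<le> \<bar>f x\<bar>" for n
        by (intro AE_I2) (use bump_bound in \<open>auto simp: abs_mult intro: mult_left_le\<close>)
    qed (use f(1) in \<open>auto intro!: tendsto_mult_left bump_tendsto\<close>)
    ultimately have "(LINT x|lborel. f x * indicator {a<..<b} x) = 0"
      by (simp add: LIMSEQ_const_iff)
    also have "(LINT x|lborel. f x * indicator {a<..<b} x) = (LINT x|lborel. f x * indicator {a..b} x)"
    proof (rule integral_cong_AE)
      show "AE x in lborel. f x * indicator {a<..<b} x = f x * indicator {a..b} x"
        using AE_lborel_singleton[of a] AE_lborel_singleton[of b]
        by eventually_elim (auto simp: indicator_def)
    qed (use f(1) in auto)
    finally show ?thesis using primitive_diff[OF f(1) that(2)] by simp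
  qed
  have const: "primitive f x = primitive f (T / 2)" if "x \<in> {0..T}" for x
  proof (rule continuous_constant_on_closure[of "{0<..<T}" "primitive f"])
    show "continuous_on (closure {0<..<T}) (primitive f)"
      using continuous_primitive[OF f(1)] continuous_on_subset by blast
    show "primitive f y = primitive f (T / 2)" if "y \<in> {0<..<T}" for y
      using inner[of y "T / 2"] inner[of "T / 2" y] that \<open>T > 0\<close> by (cases "y \<le> T / 2") auto
    show "x \<in> closure {0<..<T}" using that \<open>T > 0\<close> by (simp add: closure_greaterThanLessThan)
  qed
  have below: "primitive f x = 0" if "x \<le> 0" for x
  proof -
    have "f y * indicator {..x} y = 0" for y
      using that f(2)[of y] by (cases "y \<in> {0<..<T}") (auto simp: indicator_def)
    then show ?thesis by (simp only: primitive_def) simp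
  qed
  have above: "primitive f x = (LINT x|lborel. f x)" if "x \<ge> T" for x
  proof -
    have "f y * indicator {..x} y = f y" for y
      using that f(2)[of y] by (cases "y \<in> {0<..<T}") (auto simp: indicator_def)
    then show ?thesis by (simp only: primitive_def)
  qed
  have zero: "primitive f x = 0" for x
    using below[of x] below[of 0] const[of x] const[of 0] const[of T] above[of x] above[of T] \<open>T > 0\<close>
    by (cases "x \<le> 0"; cases "x \<le> T") auto
  show ?thesis
  proof (rule integral_intervals_eq_0_imp_AE_eq_0[OF f(1)])
    show "(LINT x|lborel. f x) = 0" using above[of T] zero[of T] by simp
    show "(LINT x|lborel. f x * indicator {a..b} x) = 0" if "a \<le> b" for a b
      using primitive_diff[OF f(1) that] zero by simp
  qed
qed

lemma test_function_borel:
  assumes "\<phi> \<in> test_functions T"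
  shows "\<phi> \<in> borel_measurable borel" "deriv \<phi> \<in> borel_measurable borel"
proof -
  have "smooth \<phi>" using assms by (auto simp: test_functions_def smooth_def)
  then show "\<phi> \<in> borel_measurable borel" "deriv \<phi> \<in> borel_measurable borel"
    by (auto intro!: borel_measurable_continuous_onI smooth_continuous smooth_deriv)
qed

lemma integrable_mult_test_function:
  assumes "integrable lborel f" "\<phi> \<in> test_functions T"
  shows "integrable lborel (\<lambda>x. f x * \<phi> x)"
  using assms(2)
proof (cases rule: test_functionsE)
  case (1 a b)
  have "continuous_on {a..b} \<phi>" using 1 smooth_continuous continuous_on_subset by blast
  then have "bounded (\<phi> ` {a..b})" by (intro compact_imp_bounded compact_continuous_image) auto
  then obtain C where C: "C > 0" "\<And>x. x \<in> {a..b} \<Longrightarrow> \<bar>\<phi> x\<bar> \<le> C"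
    unfolding bounded_pos by auto
  show ?thesis
  proof (rule integrable_lborel_mult_bounded[OF assms(1), of _ C])
    show "\<bar>\<phi> x\<bar> \<le> C" for x using C 1(2)[of x] by (cases "x \<in> {a..b}") auto
  qed (use test_function_borel assms in auto)
qed simp

lemma weak_deriv_is_weak_deriv:
  "is_weak_deriv T g h \<Longrightarrow> is_weak_deriv T g (weak_deriv T g)"
  unfolding weak_deriv_def by (rule someI[of "is_weak_deriv T g"])

lemma weak_deriv_unique_AE:
  assumes "T > 0" "is_weak_deriv T u h" "is_weak_deriv T u k"
    and h': "L1_representative T h h'" and k': "L1_representative T k k'"
  shows "AE x in lborel. h' x = k' x"
proof -
  have "AE x in lborel. h' x - k' x = 0"
  proof (rule AE_eq_0_if_orthogonal_to_test_functions[of _ T])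
    show "integrable lborel (\<lambda>x. h' x - k' x)" "\<And>x. x \<notin> {0<..<T} \<Longrightarrow> h' x - k' x = 0"
      using h' k' by (auto simp: L1_representative_def)
    fix \<phi> assume \<phi>: "\<phi> \<in> test_functions T"
    have "(LINT x|lborel. (h' x - k' x) * \<phi> x) =
       (LINT x|lborel. h' x * \<phi> x) - (LINT x|lborel. k' x * \<phi> x)"
      using h' k' \<phi> unfolding left_diff_distrib
      by (intro Bochner_Integration.integral_diff integrable_mult_test_function)
        (auto simp: L1_representative_def)
    also have "\<dots> = 0"
      using assms(2,3) \<phi> L1_representative_integral_mult[OF h' test_function_borel(1)[OF \<phi>]]
        L1_representative_integral_mult[OF k' test_function_borel(1)[OF \<phi>]]
      by (auto simp: is_weak_deriv_def)
    finally show "(LINT x|lborel. (h' x - k' x) * \<phi> x) = 0" .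
  qed fact
  then show ?thesis by simp
qed

text \<open>The constant \<open>c\<close> is harmless because the derivative of a test function has integral \<open>0\<close>; what
remains is integration by parts.\<close>

lemma weak_deriv_primitive:
  assumes f: "integrable lborel f" "\<And>x. x \<notin> {0<..<T} \<Longrightarrow> f x = 0"
    and u: "\<And>x. x \<in> {0<..<T} \<Longrightarrow> u x = c + primitive f x"
  shows "is_weak_deriv T u f"
  unfolding is_weak_deriv_def
proof (intro conjI ballI)
  have f': "L1_representative T f f" using f by (auto simp: L1_representative_def)
  have "AE x in lborel. indicator {0<..<T} x * f x = f x"
    using L1_representative_AE[OF f'] .
  with f show "set_integrable lebesgue {0<..<T} f"
    by (subst set_lebesgue_integral_lborel(2)) auto
  fix \<phi> assume \<phi>: "\<phi> \<in> test_functions T"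
  have f\<phi>: "(LINT x:{0<..<T}|lebesgue. f x * \<phi> x) = (LINT x|lborel. f x * \<phi> x)"
    using L1_representative_integral_mult[OF f'] test_function_borel[OF \<phi>] by simp
  show "(LINT x:{0<..<T}|lebesgue. u x * deriv \<phi> x) = - (LINT x:{0<..<T}|lebesgue. f x * \<phi> x)"
    using \<phi>
  proof (cases rule: test_functionsE)
    case (1 a b)
    have d0: "deriv \<phi> x = 0" if "x \<notin> {a..b}" for x
      using deriv_eq_0_outside[of a b \<phi> x] 1 that by blast
    have d: "integrable lborel (deriv \<phi>)"
      by (rule continuous_compact_support_integrable[of _ a b])
        (use 1 d0 in \<open>auto intro: smooth_continuous smooth_deriv\<close>)
    have P: "primitive f \<in> borel_measurable borel"
      by (rule borel_measurable_continuous_onI[OF continuous_primitive[OF f(1)]])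
    have Pd: "integrable lborel (\<lambda>x. primitive f x * deriv \<phi> x)"
    proof (rule continuous_compact_support_integrable[of _ a b])
      show "continuous_on UNIV (\<lambda>x. primitive f x * deriv \<phi> x)"
        by (intro continuous_intros continuous_primitive f smooth_continuous smooth_deriv 1)
    qed (use d0 in auto)
    have "(LINT x:{0<..<T}|lebesgue. u x * deriv \<phi> x) =
        (LINT x|lborel. c * deriv \<phi> x + primitive f x * deriv \<phi> x)"
    proof (rule set_lebesgue_integral_lborel(1))
      have "indicator {0<..<T} x * (u x * deriv \<phi> x) = c * deriv \<phi> x + primitive f x * deriv \<phi> x" for x
        using 1 u[of x] d0[of x] by (cases "x \<in> {0<..<T}") (auto simp: algebra_simps)
      then show "AE x in lborel. indicator {0<..<T} x * (u x * deriv \<phi> x) = c * deriv \<phi> x + primitive f x * deriv \<phi> x"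
        by simp
    qed (use d P in measurable)
    also have "\<dots> = c * (LINT x|lborel. deriv \<phi> x) + (LINT x|lborel. primitive f x * deriv \<phi> x)"
      using d Pd by simp
    also have "\<dots> = - (LINT x|lborel. f x * \<phi> x)"
      using integral_deriv_eq_0[of \<phi> a b] integral_primitive_mult_deriv[OF f(1), of \<phi> a b] 1 by simp
    finally show ?thesis using f\<phi> by simp
  qed simp
qed

section \<open>Recovering a function from its weak derivative\<close>

text \<open>Near \<open>x\<close> the primitive is an integral from \<open>x - 1\<close> up to a constant, to which the fundamental
theorem of calculus applies.\<close>

lemma primitive_has_derivative:
  assumes \<psi>: "continuous_on UNIV \<psi>" "integrable lborel \<psi>"
  shows "(primitive \<psi> has_real_derivative \<psi> x) (at x)"
proof -
  have eq: "primitive \<psi> y = primitive \<psi> (x - 1) + integral {x - 1..y} \<psi>" if "x - 1 \<le> y" for y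
  proof -
    have "set_integrable lborel {x - 1..y} \<psi>"
      by (intro borel_integrable_atLeastAtMost' continuous_on_subset[OF \<psi>(1)]) auto
    from set_borel_integral_eq_integral(2)[OF this] show ?thesis
      using primitive_diff[OF \<psi>(2) that] by (simp add: set_lebesgue_integral_def mult.commute)
  qed
  have "((\<lambda>y. integral {x - 1..y} \<psi>) has_real_derivative \<psi> x) (at x within {x - 1..x + 1})"
    by (intro integral_has_real_derivative continuous_on_subset[OF \<psi>(1)]) auto
  then have "((\<lambda>y. integral {x - 1..y} \<psi>) has_real_derivative \<psi> x) (at x)"
    by (simp add: at_within_Icc_at)
  then have "((\<lambda>y. primitive \<psi> (x - 1) + integral {x - 1..y} \<psi>) has_real_derivative \<psi> x) (at x)"
    by (auto intro!: derivative_eq_intros)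
  moreover have "\<forall>\<^sub>F y in nhds x. primitive \<psi> (x - 1) + integral {x - 1..y} \<psi> = primitive \<psi> y"
    using eventually_nhds_in_open[of "{x - 1<..}" x] by (rule eventually_mono) (auto intro: eq[symmetric])
  ultimately show ?thesis
    by (rule DERIV_cong_ev[OF refl _ refl, THEN iffD1, rotated])
qed

lemma primitive_eq_0:
  assumes "\<And>y. y \<le> x \<Longrightarrow> f y = 0" shows "primitive f x = 0"
proof -
  have "f y * indicator {..x} y = 0" for y using assms[of y] by (cases "y \<le> x") simp_all
  then show ?thesis by (simp only: primitive_def) simp
qed

lemma primitive_eq_total:
  assumes "\<And>y. y > x \<Longrightarrow> f y = 0" shows "primitive f x = (LINT y|lborel. f y)"
proof -
  have "f y * indicator {..x} y = f y" for y using assms[of y] by (cases "y \<le> x") simp_all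
  then show ?thesis by (simp only: primitive_def)
qed

text \<open>The difference \<open>\<psi> x - \<psi> (x - t)\<close> of a test function and its translate is the derivative of a test
function, namely of the integral of \<open>\<psi>\<close> over the moving window \<open>[x - t,x]\<close>: that integral
vanishes as soon as the window lies to the left or to the right of the support of \<open>\<psi>\<close>.\<close>

lemma smooth_window_primitive:
  assumes \<psi>: "\<psi> \<in> test_functions (T - t)" and "t > 0" "t < T"
  defines "\<Phi> \<equiv> (\<lambda>x. primitive \<psi> x - primitive \<psi> (x - t))"
  shows "\<Phi> \<in> test_functions T" "deriv \<Phi> x = \<psi> x - \<psi> (x - t)"
proof -
  have sm: "smooth \<psi>" using \<psi> by (auto simp: test_functions_def smooth_def)
  have int: "integrable lborel \<psi>"
    using \<psi>
  proof (cases rule: test_functionsE)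
    case (1 a b)
    then show ?thesis by (intro continuous_compact_support_integrable[of \<psi> a b] smooth_continuous)
  qed simp
  have d: "(\<Phi> has_real_derivative \<psi> x - \<psi> (x - t)) (at x)" for x
  proof -
    have P: "(primitive \<psi> has_real_derivative \<psi> y) (at y)" for y
      by (rule primitive_has_derivative[OF smooth_continuous[OF sm] int])
    have "((\<lambda>x. x - t) has_real_derivative 1) (at x)" by (auto intro!: derivative_eq_intros)
    from DERIV_chain2[OF P[of "x - t"] this] P[of x] show ?thesis
      unfolding \<Phi>_def by (auto intro!: DERIV_diff)
  qed
  then show "deriv \<Phi> x = \<psi> x - \<psi> (x - t)" by (rule DERIV_imp_deriv)
  have "smooth (\<lambda>x. \<psi> x - \<psi> (1 * x + - t))"
    by (rule smooth_diff[OF sm smooth_affine[OF sm]])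
  then have sm\<Phi>: "smooth \<Phi>" by (intro smoothI[OF d]) simp
  show "\<Phi> \<in> test_functions T"
    using \<psi>
  proof (cases rule: test_functionsE)
    case (1 a b)
    show ?thesis
    proof (rule test_functionsI[OF sm\<Phi>, of a "b + t"])
      fix x assume x: "x \<notin> {a..b + t}"
      show "\<Phi> x = 0"
      proof (cases "x < a")
        case True
        then have "primitive \<psi> x = 0" "primitive \<psi> (x - t) = 0"
          using 1(2) \<open>t > 0\<close> by (auto intro!: primitive_eq_0)
        then show ?thesis by (simp add: \<Phi>_def)
      next
        case False
        then have "primitive \<psi> x = (LINT y|lborel. \<psi> y)" "primitive \<psi> (x - t) = (LINT y|lborel. \<psi> y)"
          using 1(2) x \<open>t > 0\<close> by (auto intro!: primitive_eq_total)
        then show ?thesis by (simp add: \<Phi>_def)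
      qed
    qed (use 1 in auto)
  next
    case 2
    have "\<Phi> = (\<lambda>x. 0)" by (simp add: \<Phi>_def 2 primitive_def)
    \<comment> \<open>For the zero function any interval inside \<open>(0,T)\<close> will do.\<close>
    then show ?thesis by (intro test_functionsI[of _ "T/2" "T/2"]) (use assms smooth_const in auto)
  qed
qed

lemma continuous_L1_representative:
  fixes g :: "real \<Rightarrow> real"
  assumes "continuous_on {0..T} g"
  shows "L1_representative T g (\<lambda>x. indicator {0<..<T} x * g x)"
proof -
  have "set_integrable lborel {0..T} g" by (rule borel_integrable_atLeastAtMost'[OF assms])
  then have "set_integrable lborel {0<..<T} g"
    by (rule set_integrable_subset) auto
  then show ?thesis by (auto simp: L1_representative_def set_integrable_def)
qed

text \<open>The set where a continuous function does not vanish is open, and a nonempty open set has positive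
measure.\<close>

lemma AE_eq_0_imp_eq_0:
  fixes w :: "real \<Rightarrow> real"
  assumes "AE x in lborel. x \<in> {a<..<b} \<longrightarrow> w x = 0" "continuous_on {a<..<b} w" "x \<in> {a<..<b}"
  shows "w x = 0"
proof (rule ccontr)
  assume "w x \<noteq> 0"
  define S where "S = {a<..<b} \<inter> w -` (- {0})"
  have "open S" unfolding S_def
    by (rule continuous_open_preimage[OF assms(2)]) auto
  moreover have "S \<noteq> {}" using \<open>w x \<noteq> 0\<close> assms(3) by (auto simp: S_def)
  ultimately have "\<not> negligible S" by (rule open_not_negligible)
  moreover have "AE y in lebesgue. y \<notin> S"
    using assms(1) unfolding AE_completion_iff by eventually_elim (auto simp: S_def)
  ultimately show False
    using \<open>open S\<close> by (simp add: negligible_iff_null_sets AE_iff_null_sets)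
qed

text \<open>Testing with the window primitives of \<open>smooth_window_primitive\<close> and shifting the integration variable
gives \<open>\<integral> (u x - u (x + t)) \<psi> x dx = 0\<close> for every test function \<open>\<psi>\<close> on \<open>(0,T - t)\<close>. So
\<open>u x = u (x + t)\<close> by the fundamental lemma and continuity, for all \<open>t\<close>, which is constancy.\<close>

lemma weak_deriv_0_imp_const:
  fixes u u' :: "real \<Rightarrow> real"
  assumes "T > 0" and u: "continuous_on {0..T} u"
    and u'_def: "u' = (\<lambda>x. indicator {0<..<T} x * u x)"
    and zero: "\<And>\<phi>. \<phi> \<in> test_functions T \<Longrightarrow> (LINT x|lborel. u' x * deriv \<phi> x) = 0"
    and x: "x \<in> {0..T}"
  shows "u x = u 0"
proof -
  have u': "integrable lborel u'"
    using continuous_L1_representative[OF u] by (simp add: u'_def L1_representative_def)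
  have shift: "u x = u (x + t)" if "0 < t" "t < T" "x \<in> {0<..<T - t}" for x t
  proof -
    define f where "f x = indicator {0<..<T - t} x * (u' x - u' (x + t))" for x
    have u't: "integrable lborel (\<lambda>x. u' (x + t))"
      using lborel_integrable_real_affine[OF u', of 1 t] by (simp add: add.commute)
    have f: "integrable lborel f"
      unfolding f_def by (rule integrable_mult_indicator[where 'b=real, unfolded real_scaleR_def]) (use u' u't in auto)
    have "AE x in lborel. f x = 0"
    proof (rule AE_eq_0_if_orthogonal_to_test_functions[OF f])
      fix \<psi> assume \<psi>: "\<psi> \<in> test_functions (T - t)"
      have \<psi>0: "\<psi> x = 0" if "x \<notin> {0<..<T - t}" for x
        using \<psi> that closure_subset[of "{x. \<psi> x \<noteq> 0}"] by (auto simp: test_functions_def)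
      note win = smooth_window_primitive[OF \<psi> \<open>0 < t\<close> \<open>t < T\<close>]
      have i0: "integrable lborel (\<lambda>x. u' x * \<psi> x)"
        and i1: "integrable lborel (\<lambda>x. u' (x + t) * \<psi> x)"
        using integrable_mult_test_function[OF u' \<psi>] integrable_mult_test_function[OF u't \<psi>] .
      have i2: "integrable lborel (\<lambda>x. u' x * \<psi> (x - t))"
        using lborel_integrable_real_affine[OF i1, of 1 "- t"] by simp
      have "(LINT x|lborel. f x * \<psi> x) = (LINT x|lborel. u' x * \<psi> x - u' (x + t) * \<psi> x)"
        using \<psi>0 by (intro Bochner_Integration.integral_cong) (auto simp: f_def indicator_def algebra_simps)
      also have "\<dots> = (LINT x|lborel. u' x * \<psi> x) - (LINT x|lborel. u' (x + t) * \<psi> x)"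
        using i0 i1 by (rule Bochner_Integration.integral_diff)
      also have "(LINT x|lborel. u' (x + t) * \<psi> x) = (LINT x|lborel. u' x * \<psi> (x - t))"
        using lborel_integral_real_affine[of 1 "\<lambda>x. u' (x + t) * \<psi> x" "- t"] by simp
      also have "(LINT x|lborel. u' x * \<psi> x) - (LINT x|lborel. u' x * \<psi> (x - t)) =
          (LINT x|lborel. u' x * \<psi> x - u' x * \<psi> (x - t))"
        using i0 i2 by (rule Bochner_Integration.integral_diff[symmetric])
      also have "\<dots> = 0"
        using zero[OF win(1)] by (simp add: win(2) right_diff_distrib)
      finally show "(LINT x|lborel. f x * \<psi> x) = 0" .
    qed (use that in \<open>auto simp: f_def\<close>)
    then have "AE x in lborel. x \<in> {0<..<T - t} \<longrightarrow> u x - u (x + t) = 0"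
      by eventually_elim (use that in \<open>auto simp: f_def u'_def indicator_def split: if_splits\<close>)
    moreover have "continuous_on {0<..<T - t} (\<lambda>x. u x - u (x + t))"
      using that by (intro continuous_intros continuous_on_compose2[OF u] continuous_on_subset[OF u]) auto
    ultimately have "u x - u (x + t) = 0"
      by (rule AE_eq_0_imp_eq_0) (use that in auto)
    then show ?thesis by simp
  qed
  have "u x = u (T / 2)" if "x \<in> {0..T}" for x
  proof (rule continuous_constant_on_closure[of "{0<..<T}" u])
    show "continuous_on (closure {0<..<T}) u" using u \<open>T > 0\<close> by simp
    show "u y = u (T / 2)" if "y \<in> {0<..<T}" for y
    proof (cases y "T / 2" rule: linorder_cases)
      case less
      then show ?thesis using shift[of "T / 2 - y" y] that by simp
    next
      case greater
      then show ?thesis using shift[of "y - T / 2" "T / 2"] that \<open>T > 0\<close> by simp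
    qed (simp only:)
    show "x \<in> closure {0<..<T}" using that \<open>T > 0\<close> by simp
  qed
  from this[of x] this[of 0] show ?thesis using x \<open>T > 0\<close> by simp
qed

text \<open>The difference of \<open>g\<close> and the primitive of its weak derivative is continuous with weak derivative
\<open>0\<close>, hence equal to its value at \<open>0\<close>.\<close>

lemma W11_eq_primitive:
  assumes "T > 0" and g: "continuous_on {0..T} g" and h: "is_weak_deriv T g h"
    and h': "L1_representative T h h'" and x: "x \<in> {0..T}"
  shows "g x = g 0 + primitive h' x"
proof -
  have ih: "integrable lborel h'" and h0: "\<And>x. x \<notin> {0<..<T} \<Longrightarrow> h' x = 0"
    using h' by (auto simp: L1_representative_def)
  define u where "u x = g x - primitive h' x" for x
  have P: "continuous_on UNIV (primitive h')" by (rule continuous_primitive[OF ih])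
  have u: "continuous_on {0..T} u"
    unfolding u_def by (intro continuous_intros g continuous_on_subset[OF P]) auto
  have "u x = u 0"
  proof (rule weak_deriv_0_imp_const[OF \<open>T > 0\<close> u refl _ x])
    fix \<phi> assume \<phi>: "\<phi> \<in> test_functions T"
    show "(LINT x|lborel. indicator {0<..<T} x * u x * deriv \<phi> x) = 0"
      using \<phi>
    proof (cases rule: test_functionsE)
      case (1 a b)
      have d0: "deriv \<phi> x = 0" if "x \<notin> {a..b}" for x
        using deriv_eq_0_outside[of a b \<phi> x] 1 that by blast
      have d\<phi>: "deriv \<phi> \<in> test_functions T"
        by (rule test_functionsI[of _ a b]) (use 1 d0 smooth_deriv in auto)
      let ?g = "\<lambda>x. indicator {0<..<T} x * g x"
      have g': "L1_representative T g ?g" by (rule continuous_L1_representative[OF g])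
      have ig: "integrable lborel (\<lambda>x. ?g x * deriv \<phi> x)"
        using integrable_mult_test_function[OF _ d\<phi>] g' by (auto simp: L1_representative_def)
      have iP: "integrable lborel (\<lambda>x. primitive h' x * deriv \<phi> x)"
      proof (rule continuous_compact_support_integrable[of _ a b])
        show "continuous_on UNIV (\<lambda>x. primitive h' x * deriv \<phi> x)"
          by (intro continuous_intros P smooth_continuous smooth_deriv 1)
      qed (use d0 in auto)
      have "(LINT x|lborel. indicator {0<..<T} x * u x * deriv \<phi> x) =
          (LINT x|lborel. ?g x * deriv \<phi> x - primitive h' x * deriv \<phi> x)"
      proof (rule Bochner_Integration.integral_cong[OF refl])
        show "indicator {0<..<T} x * u x * deriv \<phi> x = ?g x * deriv \<phi> x - primitive h' x * deriv \<phi> x" for x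
          using d0[of x] 1 by (cases "x \<in> {0<..<T}") (auto simp: u_def algebra_simps)
      qed
      also have "\<dots> = (LINT x|lborel. ?g x * deriv \<phi> x) - (LINT x|lborel. primitive h' x * deriv \<phi> x)"
        using ig iP by (rule Bochner_Integration.integral_diff)
      also have "(LINT x|lborel. ?g x * deriv \<phi> x) = (LINT x:{0<..<T}|lebesgue. g x * deriv \<phi> x)"
        using L1_representative_integral_mult[OF g'] test_function_borel(2)[OF \<phi>] by simp
      also have "\<dots> = - (LINT x:{0<..<T}|lebesgue. h x * \<phi> x)"
        using h \<phi> by (simp add: is_weak_deriv_def)
      also have "(LINT x:{0<..<T}|lebesgue. h x * \<phi> x) = (LINT x|lborel. h' x * \<phi> x)"
        using L1_representative_integral_mult[OF h'] test_function_borel(1)[OF \<phi>] by simp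
      also have "(LINT x|lborel. primitive h' x * deriv \<phi> x) = - (LINT x|lborel. h' x * \<phi> x)"
        using integral_primitive_mult_deriv[OF ih, of \<phi> a b] 1 by simp
      finally show ?thesis by simp
    qed simp
  qed
  moreover have "primitive h' 0 = 0" by (rule primitive_eq_0) (use h0 in auto)
  ultimately show ?thesis by (simp add: u_def)
qed

section \<open>Convolution of integrable functions\<close>

definition convolution :: "(real \<Rightarrow> real) \<Rightarrow> (real \<Rightarrow> real) \<Rightarrow> real \<Rightarrow> real" where
  "convolution f g x = (LINT s|lborel. f (x - s) * g s)"

lemma lborel_integral_shift: "(LINT y|lborel. F (y - s)) = (LINT y|lborel. F y)"
  for F :: "real \<Rightarrow> real"
  using lborel_integral_real_affine[of 1 F "- s"] by simp

lemma lborel_integrable_shift: "integrable lborel F \<Longrightarrow> integrable lborel (\<lambda>y. F (y - s))"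
  for F :: "real \<Rightarrow> real"
  using lborel_integrable_real_affine[of F 1 "- s"] by simp

lemma integrable_convolution_kernel:
  fixes f g :: "real \<Rightarrow> real"
  assumes f: "integrable lborel f" and g: "integrable lborel g"
  shows "integrable (lborel \<Otimes>\<^sub>M lborel) (\<lambda>(s, x). f (x - s) * g s)"
proof (rule lborel_pair.Fubini_integrable)
  have [measurable]: "f \<in> borel_measurable borel" "g \<in> borel_measurable borel"
    using f g by auto
  show "(\<lambda>(s, x). f (x - s) * g s) \<in> borel_measurable (lborel \<Otimes>\<^sub>M lborel)"
    by measurable
  have "(LINT x|lborel. norm (f (x - s) * g s)) = (LINT x|lborel. \<bar>f x\<bar>) * \<bar>g s\<bar>" for s
    using lborel_integral_shift[of "\<lambda>y. \<bar>f y\<bar>" s] by (simp add: abs_mult)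
  then show "integrable lborel (\<lambda>s. LINT x|lborel. norm (case (s, x) of (s, x) \<Rightarrow> f (x - s) * g s))"
    using g by simp
  show "AE s in lborel. integrable lborel (\<lambda>x. case (s, x) of (s, x) \<Rightarrow> f (x - s) * g s)"
    using lborel_integrable_shift[OF f] by (intro AE_I2) simp
qed

lemma convolution_integrable:
  assumes "integrable lborel f" "integrable lborel g"
  shows "integrable lborel (convolution f g)"
  using lborel_pair.integrable_snd[OF integrable_convolution_kernel[OF assms]]
  by (simp add: convolution_def[abs_def])

lemma integral_convolution:
  assumes "integrable lborel f" "integrable lborel g"
  shows "(LINT x|lborel. convolution f g x) = (LINT x|lborel. f x) * (LINT x|lborel. g x)"
  using lborel_pair.Fubini_integral[OF integrable_convolution_kernel[OF assms]]
  by (simp add: convolution_def lborel_integral_shift)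

lemma abs_convolution_le:
  "\<bar>convolution f g x\<bar> \<le> convolution (\<lambda>y. \<bar>f y\<bar>) (\<lambda>y. \<bar>g y\<bar>) x"
  unfolding convolution_def
  using integral_abs_bound[of lborel "\<lambda>s. f (x - s) * g s"] by (simp add: abs_mult)

text \<open>Young's inequality in \<open>L\<^sup>1\<close>: the inequality \<open>\<bar>f * g\<bar> \<le> \<bar>f\<bar> * \<bar>g\<bar>\<close> holds pointwise, and the
integral of a convolution is the product of the integrals.\<close>

lemma convolution_L1_le:
  assumes "integrable lborel f" "integrable lborel g"
  shows "(LINT x|lborel. \<bar>convolution f g x\<bar>) \<le> (LINT x|lborel. \<bar>f x\<bar>) * (LINT x|lborel. \<bar>g x\<bar>)"
proof -
  have "(LINT x|lborel. \<bar>convolution f g x\<bar>) \<le>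
      (LINT x|lborel. convolution (\<lambda>y. \<bar>f y\<bar>) (\<lambda>y. \<bar>g y\<bar>) x)"
    using assms by (intro integral_mono abs_convolution_le integrable_abs convolution_integrable)
  also have "\<dots> = (LINT x|lborel. \<bar>f x\<bar>) * (LINT x|lborel. \<bar>g x\<bar>)"
    using assms by (intro integral_convolution integrable_abs)
  finally show ?thesis .
qed

text \<open>Fubini's theorem, together with the shift that turns \<open>\<integral> f (y - s) dy\<close> over \<open>y \<le> x\<close> into the
primitive of \<open>f\<close> at \<open>x - s\<close>.\<close>

lemma primitive_convolution:
  assumes f: "integrable lborel f" and g: "integrable lborel g"
  shows "primitive (convolution f g) x = convolution (primitive f) g x"
proof -
  have [measurable]: "f \<in> borel_measurable borel" "g \<in> borel_measurable borel"
    using f g by auto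
  have "integrable (lborel \<Otimes>\<^sub>M lborel) (\<lambda>(s, y). f (y - s) * g s * indicator {..x} y)"
    by (rule Bochner_Integration.integrable_bound[OF integrable_convolution_kernel[OF f g]])
       (auto simp: indicator_def split_beta' intro!: AE_I2)
  from lborel_pair.Fubini_integral[OF this]
  have "(LINT y|lborel. LINT s|lborel. f (y - s) * g s * indicator {..x} y) =
      (LINT s|lborel. LINT y|lborel. f (y - s) * g s * indicator {..x} y)" by simp
  also have "(\<lambda>s. LINT y|lborel. f (y - s) * g s * indicator {..x} y) = (\<lambda>s. primitive f (x - s) * g s)"
  proof
    fix s
    have "(LINT y|lborel. f (y - s) * g s * indicator {..x} y) =
        (LINT y|lborel. (\<lambda>y. f y * indicator {..x - s} y * g s) (y - s))"
      by (intro Bochner_Integration.integral_cong) (auto simp: indicator_def)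
    also have "\<dots> = (LINT y|lborel. f y * indicator {..x - s} y * g s)"
      by (rule lborel_integral_shift)
    finally show "(LINT y|lborel. f (y - s) * g s * indicator {..x} y) = primitive f (x - s) * g s"
      by (simp add: primitive_def)
  qed
  finally show ?thesis
    by (simp add: primitive_def[of "convolution f g"] convolution_def)
qed

section \<open>The convolution operator on \<open>W\<^sup>1\<^sup>,\<^sup>1\<close>\<close>

text \<open>Since \<open>P\<close> may fail to be measurable, the substitution is applied to a measurable null set that
contains the exceptional points.\<close>

lemma AE_lborel_reflect:
  fixes P :: "real \<Rightarrow> bool"
  assumes "AE y in lborel. P y" shows "AE s in lborel. P (x - s)"
proof -
  obtain N where N: "{y. \<not> P y} \<subseteq> N" "N \<in> null_sets lborel"
    using assms by (auto simp: eventually_ae_filter)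
  then have [measurable]: "N \<in> sets borel" by auto
  have "AE y in lborel. y \<notin> N" using N(2) by (rule AE_not_in)
  then have "AE s in lborel. x + (-1) * s \<notin> N"
    by (intro AE_borel_affine[of "-1" "\<lambda>y. y \<notin> N" x]) auto
  then show ?thesis by eventually_elim (use N(1) in auto)
qed

text \<open>For \<open>x \<le> T\<close> the product \<open>\<nu>' (x - s) g' s\<close> vanishes unless \<open>0 < s < x\<close>, because the
representatives vanish outside \<open>(0,T)\<close>. So the integral over \<open>(0,x)\<close> is an integral over the
line.\<close>

lemma conv_op_eq_convolution:
  assumes "x \<in> {0..T}" and \<nu>: "L1_representative T \<nu> \<nu>'" and g: "L1_representative T g g'"
  shows "conv_op \<nu> g x = convolution g' \<nu>' x"
proof -
  have i: "integrable lborel \<nu>'" "integrable lborel g'"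
    and z: "\<And>y. y \<notin> {0<..<T} \<Longrightarrow> \<nu>' y = 0" "\<And>y. y \<notin> {0<..<T} \<Longrightarrow> g' y = 0"
    and ae: "AE y in lborel. y \<in> {0<..<T} \<longrightarrow> \<nu> y = \<nu>' y" "AE y in lborel. y \<in> {0<..<T} \<longrightarrow> g y = g' y"
    using \<nu> g by (auto simp: L1_representative_def)
  have [measurable]: "\<nu>' \<in> borel_measurable borel" "g' \<in> borel_measurable borel"
    using i by auto
  have "conv_op \<nu> g x = (LINT s|lborel. \<nu>' (x - s) * g' s)"
    unfolding conv_op_def
  proof (rule set_lebesgue_integral_lborel(1))
    show "AE s in lborel. indicator {0<..<x} s * (\<nu> (x - s) * g s) = \<nu>' (x - s) * g' s"
      using AE_lborel_reflect[OF ae(1), of x] ae(2)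
    proof eventually_elim
      case (elim s)
      show ?case
      proof (cases "s \<in> {0<..<x}")
        case True
        then show ?thesis using elim \<open>x \<in> {0..T}\<close> by auto
      next
        case False
        then have "x - s \<notin> {0<..<T} \<or> s \<notin> {0<..<T}" by auto
        then show ?thesis using False z(1)[of "x - s"] z(2)[of s] by auto
      qed
    qed
  qed simp
  also have "\<dots> = (LINT s|lborel. g' (x - s) * \<nu>' s)"
    using lborel_integral_real_affine[of "-1" "\<lambda>s. \<nu>' (x - s) * g' s" x] by (simp add: mult.commute)
  finally show ?thesis by (simp add: convolution_def)
qed

text \<open>Inserting \<open>g (x - s) = g 0 + H (x - s)\<close> for \<open>s < x\<close>, with \<open>H\<close> the primitive of \<open>h'\<close>, splits the
convolution into \<open>g 0\<close> times the primitive of \<open>\<nu>'\<close> and the convolution of \<open>H\<close> with \<open>\<nu>'\<close>. The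
latter is the primitive of \<open>h' * \<nu>'\<close>. The integrand \<open>k\<close> is cut off at \<open>T\<close>, since \<open>h' * \<nu>'\<close> may
live on \<open>(0,2 T)\<close>.\<close>

lemma conv_op_primitive:
  assumes "T > 0" and \<nu>: "L1_representative T \<nu> \<nu>'"
    and g: "continuous_on {0..T} g" "is_weak_deriv T g h" and h: "L1_representative T h h'"
  defines "k \<equiv> (\<lambda>x. indicator {0<..<T} x * (g 0 * \<nu>' x + convolution h' \<nu>' x))"
  shows "integrable lborel k"
    and "\<And>x. x \<in> {0..T} \<Longrightarrow> conv_op \<nu> g x = primitive k x"
    and "(LINT x|lborel. \<bar>k x\<bar>) \<le> (LINT x|lborel. \<bar>\<nu>' x\<bar>) * (\<bar>g 0\<bar> + (LINT x|lborel. \<bar>h' x\<bar>))"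
proof -
  have i: "integrable lborel \<nu>'" "integrable lborel h'"
    and z: "\<And>y. y \<notin> {0<..<T} \<Longrightarrow> \<nu>' y = 0" "\<And>y. y \<notin> {0<..<T} \<Longrightarrow> h' y = 0"
    using \<nu> h by (auto simp: L1_representative_def)
  let ?k = "\<lambda>x. g 0 * \<nu>' x + convolution h' \<nu>' x"
  have ic: "integrable lborel (convolution h' \<nu>')" by (rule convolution_integrable[OF i(2,1)])
  have ik: "integrable lborel ?k" using i ic by simp
  show k: "integrable lborel k"
    unfolding k_def using ik by (intro integrable_mult_indicator[where 'b=real, unfolded real_scaleR_def]) auto
  have "(LINT x|lborel. \<bar>k x\<bar>) \<le> (LINT x|lborel. \<bar>g 0\<bar> * \<bar>\<nu>' x\<bar> + \<bar>convolution h' \<nu>' x\<bar>)"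
  proof (rule integral_mono)
    show "\<bar>k x\<bar> \<le> \<bar>g 0\<bar> * \<bar>\<nu>' x\<bar> + \<bar>convolution h' \<nu>' x\<bar>" for x
      using abs_triangle_ineq[of "g 0 * \<nu>' x" "convolution h' \<nu>' x"]
      by (simp add: k_def indicator_def abs_mult)
  qed (use k i ic in auto)
  also have "\<dots> = \<bar>g 0\<bar> * (LINT x|lborel. \<bar>\<nu>' x\<bar>) + (LINT x|lborel. \<bar>convolution h' \<nu>' x\<bar>)"
    using i ic by simp
  also have "\<dots> \<le> \<bar>g 0\<bar> * (LINT x|lborel. \<bar>\<nu>' x\<bar>) + (LINT x|lborel. \<bar>h' x\<bar>) * (LINT x|lborel. \<bar>\<nu>' x\<bar>)"
    using convolution_L1_le[OF i(2,1)] by simp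
  finally show "(LINT x|lborel. \<bar>k x\<bar>) \<le> (LINT x|lborel. \<bar>\<nu>' x\<bar>) * (\<bar>g 0\<bar> + (LINT x|lborel. \<bar>h' x\<bar>))"
    by (simp add: algebra_simps)
  fix x assume x: "x \<in> {0..T}"
  let ?g = "\<lambda>x. indicator {0<..<T} x * g x"
  have "conv_op \<nu> g x = convolution ?g \<nu>' x"
    by (rule conv_op_eq_convolution[OF x \<nu> continuous_L1_representative[OF g(1)]])
  also have "\<dots> = (LINT s|lborel. g 0 * (\<nu>' s * indicator {..x} s) + primitive h' (x - s) * \<nu>' s)"
    unfolding convolution_def
  proof (rule integral_cong_AE)
    have [measurable]: "\<nu>' \<in> borel_measurable borel" using i by auto
    have [measurable]: "primitive h' \<in> borel_measurable borel"
      by (rule borel_measurable_continuous_onI[OF continuous_primitive[OF i(2)]])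
    have [measurable]: "?g \<in> borel_measurable borel"
      using continuous_L1_representative[OF g(1)] by (auto simp: L1_representative_def)
    have "(\<lambda>s. ?g (x - s)) \<in> borel_measurable borel"
      by (rule measurable_compose[OF _ \<open>?g \<in> borel_measurable borel\<close>]) measurable
    then show "(\<lambda>s. ?g (x - s) * \<nu>' s) \<in> borel_measurable lborel" by simp
    show "(\<lambda>s. g 0 * (\<nu>' s * indicator {..x} s) + primitive h' (x - s) * \<nu>' s) \<in> borel_measurable lborel"
      by measurable
    show "AE s in lborel. ?g (x - s) * \<nu>' s = g 0 * (\<nu>' s * indicator {..x} s) + primitive h' (x - s) * \<nu>' s"
      using AE_lborel_singleton[of x]
    proof eventually_elim
      case (elim s)
      consider "s \<notin> {0<..<T}" | "s \<in> {0<..<T}" "s < x" | "s \<in> {0<..<T}" "x < s"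
        using elim by linarith
      then show ?case
      proof cases
        case 1
        then show ?thesis using z(1) by simp
      next
        case 2
        then have "g (x - s) = g 0 + primitive h' (x - s)"
          using x by (intro W11_eq_primitive[OF \<open>T > 0\<close> g h]) auto
        then show ?thesis using 2 x by (simp add: algebra_simps)
      next
        case 3
        then have "primitive h' (x - s) = 0" using z(2) by (intro primitive_eq_0) auto
        then show ?thesis using 3 by simp
      qed
    qed
  qed
  also have "\<dots> = (LINT s|lborel. g 0 * (\<nu>' s * indicator {..x} s)) + (LINT s|lborel. primitive h' (x - s) * \<nu>' s)"
  proof (rule Bochner_Integration.integral_add)
    show "integrable lborel (\<lambda>s. g 0 * (\<nu>' s * indicator {..x} s))"
      using integrable_lborel_indicator[OF i(1)] by simp
    have "\<bar>primitive h' y\<bar> \<le> (LINT x|lborel. \<bar>h' x\<bar>)" for y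
    proof -
      have "\<bar>primitive h' y\<bar> \<le> (LINT x|lborel. \<bar>h' x * indicator {..y} x\<bar>)"
        unfolding primitive_def by (rule integral_abs_bound)
      also have "\<dots> \<le> (LINT x|lborel. \<bar>h' x\<bar>)"
        using i(2) by (intro integral_mono integrable_abs integrable_lborel_indicator) (auto simp: indicator_def)
      finally show ?thesis .
    qed
    moreover have "(\<lambda>s. primitive h' (x - s)) \<in> borel_measurable borel"
      by (intro borel_measurable_continuous_onI continuous_on_compose2[OF continuous_primitive[OF i(2)]] continuous_intros) auto
    ultimately have "integrable lborel (\<lambda>s. \<nu>' s * primitive h' (x - s))"
      by (intro integrable_lborel_mult_bounded[OF i(1)])
    then show "integrable lborel (\<lambda>s. primitive h' (x - s) * \<nu>' s)" by (simp add: mult.commute)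
  qed
  also have "\<dots> = g 0 * primitive \<nu>' x + primitive (convolution h' \<nu>') x"
    using primitive_convolution[OF i(2,1), of x] by (simp add: primitive_def[of \<nu>'] convolution_def)
  also have "\<dots> = (LINT y|lborel. g 0 * (\<nu>' y * indicator {..x} y) + convolution h' \<nu>' y * indicator {..x} y)"
    using i ic by (simp add: primitive_def integrable_lborel_indicator)
  also have "\<dots> = primitive k x"
    unfolding primitive_def
  proof (rule integral_cong_AE)
    show "AE y in lborel. g 0 * (\<nu>' y * indicator {..x} y) + convolution h' \<nu>' y * indicator {..x} y
        = k y * indicator {..x} y"
      \<comment> \<open>The cutoff in \<open>k\<close> excludes the point \<open>T\<close>, which matters for \<open>x = T\<close>.\<close>
      using AE_lborel_singleton[of T]
    proof eventually_elim
      case (elim y)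
      have "convolution h' \<nu>' y = 0" if "y \<le> 0"
      proof -
        have "h' (y - s) * \<nu>' s = 0" for s
          using z(1)[of s] z(2)[of "y - s"] that by (cases "s > 0") auto
        then show ?thesis by (simp only: convolution_def) simp
      qed
      then show ?case
        using z(1)[of y] x elim by (auto simp: k_def indicator_def algebra_simps)
    qed
  qed (use i ic k in \<open>auto intro!: integrable_lborel_indicator borel_measurable_integrable\<close>)
  finally show "conv_op \<nu> g x = primitive k x" .
qed

lemma kernel_integral_eq_L1:
  assumes "AE x\<in>{0<..<T} in lebesgue. \<nu> x > 0" and \<nu>: "L1_representative T \<nu> \<nu>'"
  shows "kernel_integral \<nu> T = (LINT x|lborel. \<bar>\<nu>' x\<bar>)"
  unfolding kernel_integral_def
proof (rule set_lebesgue_integral_lborel(1))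
  show "(\<lambda>x. \<bar>\<nu>' x\<bar>) \<in> borel_measurable borel" using \<nu> by (auto simp: L1_representative_def)
  show "AE x in lborel. indicator {0<..<T} x * \<nu> x = \<bar>\<nu>' x\<bar>"
    using assms(1)[unfolded AE_completion_iff] L1_representative_AE[OF \<nu>]
    by eventually_elim (auto split: split_indicator split_indicator_asm)
qed

theorem theorem5p3:
  fixes T :: real and \<nu> :: "real \<Rightarrow> real"
  assumes "T > 0"
    and "set_integrable lebesgue {0<..<T} \<nu>"
    and "AE x\<in>{0<..<T} in lebesgue. \<nu> x > 0"
  shows "\<forall>g\<in>W11 T. conv_op \<nu> g \<in> W11 T \<and>
           W11_norm T (conv_op \<nu> g) \<le> kernel_integral \<nu> T * (\<bar>g 0\<bar> + W11_norm T g)"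
proof
  fix g assume g: "g \<in> W11 T"
  obtain \<nu>' where \<nu>': "L1_representative T \<nu> \<nu>'"
    using L1_representative_exists[OF assms(2)] .
  have cont: "continuous_on {0..T} g" using g by (simp add: W11_def)
  define h where "h = weak_deriv T g"
  have h: "is_weak_deriv T g h"
    using g weak_deriv_is_weak_deriv by (auto simp: h_def W11_def)
  then obtain h' where h': "L1_representative T h h'"
    using L1_representative_exists is_weak_deriv_def by blast
  define J where "J = conv_op \<nu> g"
  define k where "k = (\<lambda>x. indicator {0<..<T} x * (g 0 * \<nu>' x + convolution h' \<nu>' x))"
  note kp = conv_op_primitive[OF assms(1) \<nu>' cont h h', folded k_def J_def]
  have J_cont: "continuous_on {0..T} J"
    using continuous_on_subset[OF continuous_primitive[OF kp(1)], of "{0..T}"]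
      continuous_on_cong[OF refl kp(2), of "{0..T}"] by simp
  have J': "L1_representative T J (\<lambda>x. indicator {0<..<T} x * J x)" (is "L1_representative T J ?J")
    by (rule continuous_L1_representative[OF J_cont])
  have J_wd: "is_weak_deriv T J k"
    by (rule weak_deriv_primitive[OF kp(1), where c=0]) (use kp(2) in \<open>auto simp: k_def\<close>)
  have "set_integrable lebesgue {0<..<T} J"
    using J' by (subst set_lebesgue_integral_lborel(2)[OF _ L1_representative_AE[OF J']])
      (auto simp: L1_representative_def)
  with J_cont J_wd have J_W11: "J \<in> W11 T" by (auto simp: W11_def)
  define l where "l = weak_deriv T J"
  have l: "is_weak_deriv T J l"
    unfolding l_def by (rule weak_deriv_is_weak_deriv[OF J_wd])
  then obtain l' where l': "L1_representative T l l'"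
    using L1_representative_exists is_weak_deriv_def by blast
  have k': "L1_representative T k k"
    using kp(1) by (auto simp: L1_representative_def k_def)
  let ?N = "kernel_integral \<nu> T"
  have N: "?N = (LINT x|lborel. \<bar>\<nu>' x\<bar>)" by (rule kernel_integral_eq_L1[OF assms(3) \<nu>'])
  have "L1_norm T l = (LINT x|lborel. \<bar>l' x\<bar>)" by (rule L1_norm_representative[OF l'])
  also have "\<dots> = (LINT x|lborel. \<bar>k x\<bar>)"
  proof (rule integral_cong_AE)
    show "AE x in lborel. \<bar>l' x\<bar> = \<bar>k x\<bar>"
      using weak_deriv_unique_AE[OF assms(1) l J_wd l' k'] by eventually_elim simp
  qed (use l' k' in \<open>auto simp: L1_representative_def\<close>)
  also have "\<dots> \<le> ?N * (\<bar>g 0\<bar> + L1_norm T h)"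
    using kp(3) by (simp add: k_def N L1_norm_representative[OF h'])
  finally have deriv_bound: "L1_norm T l \<le> ?N * (\<bar>g 0\<bar> + L1_norm T h)" .
  let ?g = "\<lambda>x. indicator {0<..<T} x * g x"
  have g': "L1_representative T g ?g" by (rule continuous_L1_representative[OF cont])
  have i: "integrable lborel ?g" "integrable lborel \<nu>'"
    using g' \<nu>' by (auto simp: L1_representative_def)
  have "L1_norm T J = (LINT x|lborel. \<bar>?J x\<bar>)" by (rule L1_norm_representative[OF J'])
  also have "\<dots> \<le> (LINT x|lborel. \<bar>convolution ?g \<nu>' x\<bar>)"
  proof (rule integral_mono)
    show "\<bar>?J x\<bar> \<le> \<bar>convolution ?g \<nu>' x\<bar>" for x
      using conv_op_eq_convolution[OF _ \<nu>' g', of x] by (cases "x \<in> {0<..<T}") (auto simp: J_def)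
    show "integrable lborel (\<lambda>x. \<bar>?J x\<bar>)" using J' by (auto simp: L1_representative_def)
    show "integrable lborel (\<lambda>x. \<bar>convolution ?g \<nu>' x\<bar>)"
      by (intro integrable_abs convolution_integrable i)
  qed
  also have "\<dots> \<le> (LINT x|lborel. \<bar>?g x\<bar>) * ?N"
    unfolding N by (rule convolution_L1_le[OF i])
  also have "\<dots> = ?N * L1_norm T g"
    using L1_norm_representative[OF g'] by (simp add: mult.commute)
  finally have "L1_norm T J \<le> ?N * L1_norm T g" .
  with deriv_bound have "W11_norm T J \<le> ?N * (\<bar>g 0\<bar> + W11_norm T g)"
    by (simp add: W11_norm_def h_def l_def algebra_simps)
  with J_W11 show "conv_op \<nu> g \<in> W11 T \<and> W11_norm T (conv_op \<nu> g) \<le> ?N * (\<bar>g 0\<bar> + W11_norm T g)"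
    by (simp add: J_def)
qed

end
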